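(* Let $\varphi,\psi\in\mathcal{F}^{\ast}$. Then for every $n\ge1$, \[\Lambda_n(1,\varphi\,|\,1,\psi)=\sum_{k=1}^n\Big(A^{\psi}_{n,k}(0)\sum_{j=1}^kA^{\varphi}_{j,1}(0)A_{k,j}\Big).\]
   Context: $\mathbb{K}$ is a field of characteristic zero, $\mathcal{F}=\mathbb{K}[[x]]$ with derivation $D$, $\mathcal{F}^{\ast}$ the set of series $g$ with $g(0)=0$, $D(g)(0)\ne0$. Partial Bell polynomials: $B_{0,0}=1$, $B_{n,0}=0$ ($n\ge1$), $B_{n,k}=0$ ($k>n$), and for $1\le k\le n$, $B_{n,k}=\sum\frac{n!}{\prod_ir_i!(i!)^{r_i}}\prod_iX_i^{r_i}$ over non-negative integers with $\sum r_i=k$, $\sum ir_i=n$. $A_{n,k}\in\mathbb{K}[X_1^{-1},X_1,X_2,\ldots]$ is the unique lower triangular family with $A_{0,0}=1$, $A_{n,0}=0$ ($n\ge1$) and $\sum_{j=k}^nA_{n,j}B_{j,k}=\delta_{nk}$. For a polynomial $P$ and function $\varphi$, $P^{\varphi}(0)$ is $P$ with each $X_j$ replaced by $D^j(\varphi)(0)$. Reciprocal polynomials: $\widehat R_m:=\sum_{i=0}^m(-1)^ii!X_0^{-(i+1)}B_{m,i}$. For $a\in\mathcal{F}_1$ (nonzero constant term) with $a_j=D^j(a)(0)$ and $\varphi\in\mathcal{F}^{\ast}$ define $\Gamma^{(1)}_n(a,\varphi):=\sum_{k=1}^n\big(\sum_{j=k}^n\binom nj a_{n-j}B^{\varphi}_{j,k}(0)\big)X_k$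 and $\bar\Gamma^{(1)}_n(a,\varphi):=\sum_{k=0}^n\big(\sum_{j=k}^n\binom jk\widehat R_{j-k}(a_0,\ldots,a_{j-k})A^{\varphi}_{n,j}(0)\big)X_k$. The generalized Lagrange inversion polynomial for $a=b=1$ (constant function) is $\Lambda_n(1,\varphi\,|\,1,\psi):=\bar\Gamma^{(1)}_n(1,\psi)\circ A_{\bullet,1}\circ\Gamma^{(1)}_{\bullet}(1,\varphi)$, i.e. in $\bar\Gamma^{(1)}_n(1,\psi)$ each $X_j$ is replaced by $A_{j,1}(\Gamma^{(1)}_1(1,\varphi),\ldots,\Gamma^{(1)}_j(1,\varphi))$, with $A_{0,1}=0$. *)

theory Defs
  imports "HOL-Library.Poly_Mapping" "HOL-Computational_Algebra.Formal_Power_Series"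
begin

text \<open>
  Laurent polynomials in the indeterminates \<open>X\<^sub>0, X\<^sub>1, X\<^sub>2, \<dots>\<close> are the elements of the
  monoid algebra over the group of finitely supported integer exponent vectors.
\<close>

type_synonym 'a lpoly = "(nat \<Rightarrow>\<^sub>0 int) \<Rightarrow>\<^sub>0 'a"

definition LConst :: "'a \<Rightarrow> 'a::comm_ring_1 lpoly" where
  "LConst c = Poly_Mapping.single 0 c"

definition LVar :: "nat \<Rightarrow> 'a::comm_ring_1 lpoly" where
  "LVar i = Poly_Mapping.single (Poly_Mapping.single i 1) 1"

definition LVar_inv :: "nat \<Rightarrow> 'a::comm_ring_1 lpoly" where
  "LVar_inv i = Poly_Mapping.single (Poly_Mapping.single i (- 1)) 1"

text \<open>The subring \<open>K[X\<^sub>1\<^sup>-\<^sup>1, X\<^sub>1, X\<^sub>2, \<dots>]\<close>.\<close>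

definition bell_ring :: "'a::comm_ring_1 lpoly set" where
  "bell_ring = {P. \<forall>m \<in> Poly_Mapping.keys P.
     Poly_Mapping.lookup m 0 = 0 \<and> (\<forall>i\<ge>2. 0 \<le> Poly_Mapping.lookup m i)}"

text \<open>
  Substitution into Laurent polynomials. The inverse is only meaningful for units; negative powers
  are only ever taken of units below (of \<open>D(\<phi>)(0)\<close>, of the constant term of a series in
  \<open>\<F>\<^sub>1\<close>, and of a nonzero scalar multiple of \<open>X\<^sub>1\<close>).
\<close>

definition unit_inv :: "'r::comm_ring_1 \<Rightarrow> 'r" where
  "unit_inv x = (THE y. x * y = 1)"

definition unit_powi :: "'r::comm_ring_1 \<Rightarrow> int \<Rightarrow> 'r" where
  "unit_powi x k = (if 0 \<le> k then x ^ nat k else unit_inv x ^ nat (- k))"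

definition lsubst :: "('a \<Rightarrow> 'r) \<Rightarrow> (nat \<Rightarrow> 'r) \<Rightarrow> 'a::comm_ring_1 lpoly \<Rightarrow> 'r::comm_ring_1" where
  "lsubst h g P = (\<Sum>m \<in> Poly_Mapping.keys P. h (Poly_Mapping.lookup P m) *
     (\<Prod>i \<in> Poly_Mapping.keys m. unit_powi (g i) (Poly_Mapping.lookup m i)))"

abbreviation leval :: "(nat \<Rightarrow> 'a) \<Rightarrow> 'a::comm_ring_1 lpoly \<Rightarrow> 'a" where
  "leval \<equiv> lsubst (\<lambda>c. c)"

abbreviation lcompose :: "'a::comm_ring_1 lpoly \<Rightarrow> (nat \<Rightarrow> 'a lpoly) \<Rightarrow> 'a lpoly" where
  "lcompose P g \<equiv> lsubst LConst g P"

definition taylor :: "'a::comm_ring_1 fps \<Rightarrow> nat \<Rightarrow> 'a" where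
  "taylor f j = fps_nth ((fps_deriv ^^ j) f) 0"

abbreviation at_zero :: "'a::comm_ring_1 lpoly \<Rightarrow> 'a fps \<Rightarrow> 'a" where
  "at_zero P \<phi> \<equiv> leval (taylor \<phi>) P"

definition Fstar :: "'a::comm_ring_1 fps set" where
  "Fstar = {g. fps_nth g 0 = 0 \<and> fps_nth (fps_deriv g) 0 \<noteq> 0}"

definition bell_types :: "nat \<Rightarrow> nat \<Rightarrow> (nat \<Rightarrow> nat) set" where
  "bell_types n k = {r. (\<forall>i. i \<notin> {1..n} \<longrightarrow> r i = 0) \<and>
     (\<Sum>i=1..n. r i) = k \<and> (\<Sum>i=1..n. i * r i) = n}"

definition bellB :: "nat \<Rightarrow> nat \<Rightarrow> 'a::field_char_0 lpoly" where
  "bellB n k =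
    (if k = 0 then (if n = 0 then 1 else 0)
     else if n < k then 0
     else (\<Sum>r \<in> bell_types n k.
       LConst (fact n / (\<Prod>i=1..n. fact (r i) * fact i ^ r i)) * (\<Prod>i=1..n. LVar i ^ r i)))"

definition is_bellA :: "(nat \<Rightarrow> nat \<Rightarrow> 'a::field_char_0 lpoly) \<Rightarrow> bool" where
  "is_bellA A \<longleftrightarrow>
     (\<forall>n k. A n k \<in> bell_ring) \<and>
     (\<forall>n k. n < k \<longrightarrow> A n k = 0) \<and>
     A 0 0 = 1 \<and> (\<forall>n\<ge>1. A n 0 = 0) \<and>
     (\<forall>n k. k \<le> n \<longrightarrow> (\<Sum>j=k..n. A n j * bellB j k) = (if n = k then 1 else 0))"

definition bellA :: "nat \<Rightarrow> nat \<Rightarrow> 'a::field_char_0 lpoly" where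
  "bellA = (THE A. is_bellA A)"

definition recipR :: "nat \<Rightarrow> 'a::field_char_0 lpoly" where
  "recipR m = (\<Sum>i=0..m. LConst ((- 1) ^ i * fact i) * LVar_inv 0 ^ (i + 1) * bellB m i)"

definition Gam :: "'a::field_char_0 fps \<Rightarrow> 'a fps \<Rightarrow> nat \<Rightarrow> 'a lpoly" where
  "Gam a \<phi> n = (\<Sum>k=1..n.
     LConst (\<Sum>j=k..n. of_nat (n choose j) * taylor a (n - j) * at_zero (bellB j k) \<phi>) * LVar k)"

definition Gam_bar :: "'a::field_char_0 fps \<Rightarrow> 'a fps \<Rightarrow> nat \<Rightarrow> 'a lpoly" where
  "Gam_bar a \<phi> n = (\<Sum>k=0..n.
     LConst (\<Sum>j=k..n. of_nat (j choose k) * leval (taylor a) (recipR (j - k)) *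
       at_zero (bellA n j) \<phi>) * LVar k)"

text \<open>The polynomial \<open>\<Lambda>\<^sub>n(1, \<phi> | 1, \<psi>)\<close>.\<close>

definition Lambda_one :: "nat \<Rightarrow> 'a::field_char_0 fps \<Rightarrow> 'a fps \<Rightarrow> 'a lpoly" where
  "Lambda_one n \<phi> \<psi> = lcompose (Gam_bar 1 \<psi> n) (\<lambda>j. lcompose (bellA j 1) (Gam 1 \<phi>))"


text \<open>Existence and uniqueness of the family \<^const>\<open>bellA\<close>.\<close>

lemma bell_ring_0 [simp]: "0 \<in> bell_ring"
  and bell_ring_1 [simp]: "1 \<in> bell_ring"
  and bell_ring_LConst [simp]: "LConst c \<in> bell_ring"
  by (auto simp: bell_ring_def LConst_def)

lemma bell_ring_LVar [simp]: "1 \<le> i \<Longrightarrow> LVar i \<in> bell_ring"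
  and bell_ring_LVar_inv [simp]: "LVar_inv 1 \<in> bell_ring"
  by (auto simp: bell_ring_def LVar_def LVar_inv_def lookup_single when_def)

lemma bell_ring_add: "P \<in> bell_ring \<Longrightarrow> Q \<in> bell_ring \<Longrightarrow> P + Q \<in> bell_ring"
  unfolding bell_ring_def using Poly_Mapping.keys_add[of P Q] by blast

lemma bell_ring_diff: "P \<in> bell_ring \<Longrightarrow> Q \<in> bell_ring \<Longrightarrow> P - Q \<in> bell_ring"
  unfolding bell_ring_def using Poly_Mapping.keys_diff[of P Q] by blast

lemma bell_ring_mult:
  assumes "P \<in> bell_ring" "Q \<in> bell_ring"
  shows "P * Q \<in> bell_ring"
  using assms Poly_Mapping.keys_mult[of P Q]
  unfolding bell_ring_def by (fastforce simp: lookup_add)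

lemma bell_ring_power: "P \<in> bell_ring \<Longrightarrow> P ^ n \<in> bell_ring"
  by (induction n) (auto simp: bell_ring_mult)

lemma bell_ring_sum: "(\<And>x. x \<in> S \<Longrightarrow> f x \<in> bell_ring) \<Longrightarrow> sum f S \<in> bell_ring"
  by (induction S rule: infinite_finite_induct) (auto simp: bell_ring_add)

lemma bell_ring_prod: "(\<And>x. x \<in> S \<Longrightarrow> f x \<in> bell_ring) \<Longrightarrow> prod f S \<in> bell_ring"
  by (induction S rule: infinite_finite_induct) (auto simp: bell_ring_mult)

lemma bell_ring_bellB: "bellB n k \<in> bell_ring"
  unfolding bellB_def
  by (auto intro!: bell_ring_sum bell_ring_mult bell_ring_prod bell_ring_power)

lemma finite_bell_types: "finite (bell_types n k)"
proof (rule finite_subset)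
  show "bell_types n k \<subseteq> {r. \<forall>i. (i \<in> {1..n} \<longrightarrow> r i \<in> {..k}) \<and> (i \<notin> {1..n} \<longrightarrow> r i = 0)}"
    using member_le_sum[of _ "{1..n}"] by (fastforce simp: bell_types_def)
  show "finite {r. \<forall>i. (i \<in> {1..n} \<longrightarrow> r i \<in> {..k}) \<and> (i \<notin> {1..n} \<longrightarrow> r i = (0::nat))}"
    by (rule finite_set_of_finite_funs) auto
qed

lemma bell_types_diag:
  assumes "1 \<le> k"
  shows "bell_types k k = {(\<lambda>i. if i = 1 then k else 0)}" (is "_ = {?r}")
proof (intro equalityI subsetI)
  fix r assume "r \<in> bell_types k k"
  then have out: "\<And>i. i \<notin> {1..k} \<Longrightarrow> r i = 0"
    and s1: "(\<Sum>i=1..k. r i) = k" and s2: "(\<Sum>i=1..k. i * r i) = k"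
    by (auto simp: bell_types_def)
  have "(\<Sum>i=1..k. i * r i) = (\<Sum>i=1..k. r i + (i - 1) * r i)"
    by (rule sum.cong) (auto simp: algebra_simps)
  then have "(\<Sum>i=1..k. (i - 1) * r i) = 0"
    using s1 s2 by (simp add: sum.distrib)
  then have z: "r i = 0" if "i \<noteq> 1" for i
    using out[of i] that by (cases "i \<in> {1..k}") (fastforce simp: le_Suc_eq)+
  have "(\<Sum>i=1..k. r i) = r 1"
    using assms z by (subst sum.remove[of _ 1]) auto
  then show "r \<in> {?r}"
    using s1 z by auto
next
  fix r assume "r \<in> {?r}"
  moreover have "(\<Sum>i=1..k. if i = 1 then k else 0) = k"
    using assms by (subst sum.remove[of _ 1]) auto
  moreover have "(\<Sum>i=1..k. i * (if i = 1 then k else 0)) = k"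
    using assms by (subst sum.remove[of _ 1]) auto
  ultimately show "r \<in> bell_types k k"
    using assms by (auto simp: bell_types_def)
qed

lemma bellB_diag: "bellB k k = (LVar 1 ^ k :: 'a::field_char_0 lpoly)"
proof (cases "k = 0")
  case False
  have c: "(\<Prod>i=1..k. fact (if i = 1 then k else 0) * fact i ^ (if i = 1 then k else 0)) = (fact k :: 'a)"
    using False by (subst prod.remove[of _ 1]) auto
  have p: "(\<Prod>i=1..k. LVar i ^ (if i = 1 then k else 0)) = (LVar 1 ^ k :: 'a lpoly)"
    using False by (subst prod.remove[of _ 1]) auto
  show ?thesis
    using False unfolding bellB_def
    by (simp add: bell_types_diag c[unfolded One_nat_def] p[unfolded One_nat_def])
       (simp add: LConst_def)
qed (simp add: bellB_def)

lemma LVar_LVar_inv: "LVar i * LVar_inv i = 1"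
  by (simp add: LVar_def LVar_inv_def mult_single single_add[symmetric])

lemma bellB_diag_inv: "bellB k k * LVar_inv 1 ^ k = 1"
  by (simp add: bellB_diag power_mult_distrib[symmetric] LVar_LVar_inv[of 1, simplified])

function bellA_aux :: "nat \<Rightarrow> nat \<Rightarrow> 'a::field_char_0 lpoly" where
  "bellA_aux n k = (if n < k then 0 else
     ((if n = k then 1 else 0) - (\<Sum>j=Suc k..n. bellA_aux n j * bellB j k)) * LVar_inv 1 ^ k)"
  by auto
termination by (relation "measure (\<lambda>(n, k). n - k)") auto

declare bellA_aux.simps [simp del]

lemma bellA_aux_sum:
  assumes "k \<le> n"
  shows "(\<Sum>j=k..n. bellA_aux n j * bellB j k) = (if n = k then 1 else (0 :: 'a::field_char_0 lpoly))"
proof -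
  let ?S = "\<Sum>j=Suc k..n. bellA_aux n j * bellB j k :: 'a lpoly"
  have "(\<Sum>j=k..n. bellA_aux n j * bellB j k) = bellA_aux n k * bellB k k + ?S"
    using assms by (simp add: sum.atLeast_Suc_atMost)
  also have "bellA_aux n k * bellB k k
      = ((if n = k then 1 else 0) - ?S) * (bellB k k * LVar_inv 1 ^ k)"
    using assms by (subst bellA_aux.simps) (simp add: mult_ac)
  finally show ?thesis
    by (simp only: bellB_diag_inv) simp
qed

lemma bellA_aux_0: "bellA_aux n 0 = (if n = 0 then 1 else 0)"
  by (subst bellA_aux.simps) (auto simp: bellB_def)

lemma bellA_aux_in: "bellA_aux n k \<in> (bell_ring :: 'a::field_char_0 lpoly set)"
proof (induction n k rule: bellA_aux.induct)
  case (1 n k)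
  then have "((if n = k then 1 else 0) - (\<Sum>j=Suc k..n. bellA_aux n j * bellB j k)) * LVar_inv 1 ^ k
      \<in> (bell_ring :: 'a lpoly set)" if "\<not> n < k"
    using that
    by (intro bell_ring_mult bell_ring_diff bell_ring_sum bell_ring_power bell_ring_bellB
          bell_ring_LVar_inv) auto
  then show ?case
    by (subst bellA_aux.simps) (simp del: One_nat_def)
qed

lemma bellA_aux_less: "n < k \<Longrightarrow> bellA_aux n k = 0"
  by (subst bellA_aux.simps) simp

lemma is_bellA_aux: "is_bellA bellA_aux"
  unfolding is_bellA_def
  by (intro conjI allI impI bellA_aux_in bellA_aux_sum)
     (simp_all add: bellA_aux_0 bellA_aux_less)

lemma is_bellA_unique:
  assumes A: "is_bellA A"
  shows "A = bellA_aux"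
proof (intro ext)
  fix n k
  show "A n k = bellA_aux n k"
  proof (induction n k rule: bellA_aux.induct)
    case (1 n k)
    show ?case
    proof (cases "n < k")
      case True
      then show ?thesis using A by (simp add: is_bellA_def bellA_aux_less)
    next
      case False
      have "(\<Sum>j=k..n. A n j * bellB j k) = (\<Sum>j=k..n. bellA_aux n j * bellB j k)"
        using False A by (simp add: is_bellA_def bellA_aux_sum)
      moreover have "(\<Sum>j=Suc k..n. A n j * bellB j k) = (\<Sum>j=Suc k..n. bellA_aux n j * bellB j k)"
        using 1 False by (intro sum.cong) auto
      ultimately have "A n k * bellB k k = bellA_aux n k * bellB k k"
        using False by (simp add: sum.atLeast_Suc_atMost)
      then have "A n k * (bellB k k * LVar_inv 1 ^ k) = bellA_aux n k * (bellB k k * LVar_inv 1 ^ k)"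
        by (simp only: mult.assoc[symmetric])
      then show ?thesis by (simp only: bellB_diag_inv mult_1_right)
    qed
  qed
qed

lemma bellA_ex1: "\<exists>!A. is_bellA A"
  using is_bellA_aux is_bellA_unique by blast

lemma is_bellA_bellA: "is_bellA bellA"
  unfolding bellA_def by (rule theI'[OF bellA_ex1])

end

theory Submission
  imports Defs
begin

text \<open>
  Up to factorials, \<open>B\<^sub>n\<^sub>,\<^sub>k\<close> evaluated at \<open>g\<close> is the \<open>n\<close>-th coefficient of the \<open>k\<close>-th power of
  the exponential generating function of \<open>g\<close>. The generating function of \<open>\<Gamma>\<^sub>\<bullet>(1, \<phi>)\<close> is the composition
  of the generic one with \<open>\<phi>\<close>, so substituting \<open>\<Gamma>\<^sub>\<bullet>(1, \<phi>)\<close> turns the matrix \<open>B\<close> into \<open>B\<^sup>\<phi> B\<close>, and hence its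
  inverse \<open>A\<close> into \<open>A A\<^sup>\<phi>\<close>. The first column of this product, multiplied by
  the matrix \<open>A\<^sup>\<psi>\<close> that \<open>\<Gamma>\<close>-bar amounts to when \<open>a = 1\<close>, is the claimed formula.
\<close>

unbundle fps_syntax

section \<open>Substitution as a ring homomorphism\<close>

text \<open>Inverses in a commutative ring are unique, so the definite description denotes as soon
  as one exists.\<close>

lemma unit_inv_right: "x dvd 1 \<Longrightarrow> x * unit_inv x = 1"
proof -
  assume "x dvd 1"
  then obtain y where "1 = x * y" by (rule dvdE)
  then have y: "x * y = 1" by simp
  have "z = y" if "x * z = 1" for z
  proof -
    have "z = z * (x * y)" using y by simp
    also have "\<dots> = (x * z) * y" by (simp only: mult_ac)
    finally show ?thesis using that by simp
  qed
  with y have "(THE y. x * y = 1) = y"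
    by (rule the_equality)
  then show ?thesis using y by (simp only: unit_inv_def)
qed

lemma unit_powi_0 [simp]: "unit_powi x 0 = 1"
  and unit_powi_1 [simp]: "unit_powi x 1 = x"
  by (simp_all add: unit_powi_def)

text \<open>Splitting an integer exponent into a difference of naturals lets additivity be proved at
  a unit without distinguishing signs.\<close>

lemma unit_powi_diff:
  assumes "x dvd 1"
  shows "unit_powi x (int a - int b) = x ^ a * unit_inv x ^ b"
proof (cases "b \<le> a")
  case True
  then have "x ^ a * unit_inv x ^ b = x ^ (a - b) * (x * unit_inv x) ^ b"
    by (simp add: power_mult_distrib mult.assoc[symmetric] power_add[symmetric])
  then show ?thesis using True assms
    by (simp add: unit_inv_right unit_powi_def nat_diff_distrib)
next
  case False
  then have "x ^ a * unit_inv x ^ b = (x * unit_inv x) ^ a * unit_inv x ^ (b - a)"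
    by (simp add: power_mult_distrib mult.assoc power_add[symmetric])
  then show ?thesis using False assms
    by (simp add: unit_inv_right unit_powi_def nat_diff_distrib)
qed

lemma unit_powi_add:
  assumes "x dvd 1 \<or> (0 \<le> k \<and> 0 \<le> l)"
  shows "unit_powi x (k + l) = unit_powi x k * unit_powi x l"
proof (cases "x dvd 1")
  case True
  obtain a b where k: "k = int a - int b" by (metis int_diff_cases)
  obtain c d where l: "l = int c - int d" by (metis int_diff_cases)
  have "k + l = int (a + c) - int (b + d)" by (simp add: k l)
  then have "unit_powi x (k + l) = x ^ (a + c) * unit_inv x ^ (b + d)"
    by (simp only: unit_powi_diff[OF True])
  then show ?thesis
    by (simp only: k l unit_powi_diff[OF True] power_add mult_ac)
next
  case False
  then show ?thesis using assms by (auto simp: unit_powi_def nat_add_distrib power_add)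
qed

definition monom_subst :: "(nat \<Rightarrow> 'r::comm_ring_1) \<Rightarrow> (nat \<Rightarrow>\<^sub>0 int) \<Rightarrow> 'r" where
  "monom_subst g m = (\<Prod>i \<in> Poly_Mapping.keys m. unit_powi (g i) (Poly_Mapping.lookup m i))"

lemma monom_subst_superset:
  assumes "finite S" "Poly_Mapping.keys m \<subseteq> S"
  shows "monom_subst g m = (\<Prod>i \<in> S. unit_powi (g i) (Poly_Mapping.lookup m i))"
  unfolding monom_subst_def using assms
  by (intro prod.mono_neutral_left) (auto simp: in_keys_iff)

definition monom_ok :: "(nat \<Rightarrow> 'r::comm_ring_1) \<Rightarrow> (nat \<Rightarrow>\<^sub>0 int) \<Rightarrow> bool" where
  "monom_ok g m \<longleftrightarrow> (\<forall>i. g i dvd 1 \<or> 0 \<le> Poly_Mapping.lookup m i)"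

lemma monom_ok_add: "monom_ok g m \<Longrightarrow> monom_ok g m' \<Longrightarrow> monom_ok g (m + m')"
  by (auto simp: monom_ok_def lookup_add) (metis add_nonneg_nonneg)

lemma monom_subst_add:
  assumes "monom_ok g m" "monom_ok g m'"
  shows "monom_subst g (m + m') = monom_subst g m * monom_subst g m'"
proof -
  let ?S = "Poly_Mapping.keys m \<union> Poly_Mapping.keys m'"
  have "monom_subst g (m + m') = (\<Prod>i\<in>?S. unit_powi (g i) (Poly_Mapping.lookup (m + m') i))"
    using Poly_Mapping.keys_add[of m m'] by (intro monom_subst_superset) auto
  also have "\<dots> = (\<Prod>i\<in>?S. unit_powi (g i) (Poly_Mapping.lookup m i)
      * unit_powi (g i) (Poly_Mapping.lookup m' i))"
    using assms by (intro prod.cong refl) (auto simp: lookup_add monom_ok_def intro: unit_powi_add)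
  also have "\<dots> = monom_subst g m * monom_subst g m'"
    by (simp add: prod.distrib monom_subst_superset[of ?S])
  finally show ?thesis .
qed

text \<open>
  The Laurent polynomials whose negative exponents sit only at units of \<open>g\<close>. Outside this
  subring substitution is not multiplicative, because \<^const>\<open>unit_inv\<close> is then a junk value.
\<close>

definition subst_dom :: "(nat \<Rightarrow> 'r::comm_ring_1) \<Rightarrow> 'a::comm_ring_1 lpoly set" where
  "subst_dom g = {P. \<forall>m \<in> Poly_Mapping.keys P. monom_ok g m}"

lemma subst_dom_0 [simp]: "0 \<in> subst_dom g"
  and subst_dom_1 [simp]: "1 \<in> subst_dom g"
  and subst_dom_LConst [simp]: "LConst c \<in> subst_dom g"
  and subst_dom_LVar [simp]: "LVar i \<in> subst_dom g"
  by (auto simp: subst_dom_def monom_ok_def LConst_def LVar_def lookup_single when_def)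

lemma subst_dom_LVar_inv: "g i dvd 1 \<Longrightarrow> LVar_inv i \<in> subst_dom g"
  by (auto simp: subst_dom_def monom_ok_def LVar_inv_def lookup_single when_def)

lemma subst_dom_add: "P \<in> subst_dom g \<Longrightarrow> Q \<in> subst_dom g \<Longrightarrow> P + Q \<in> subst_dom g"
  unfolding subst_dom_def using Poly_Mapping.keys_add[of P Q] by blast

lemma subst_dom_mult: "P \<in> subst_dom g \<Longrightarrow> Q \<in> subst_dom g \<Longrightarrow> P * Q \<in> subst_dom g"
  unfolding subst_dom_def using Poly_Mapping.keys_mult[of P Q] monom_ok_add by blast

lemma subst_dom_power: "P \<in> subst_dom g \<Longrightarrow> P ^ n \<in> subst_dom g"
  by (induction n) (auto simp: subst_dom_mult)

lemma subst_dom_sum: "(\<And>x. x \<in> S \<Longrightarrow> f x \<in> subst_dom g) \<Longrightarrow> sum f S \<in> subst_dom g"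
  by (induction S rule: infinite_finite_induct) (auto simp: subst_dom_add)

lemma subst_dom_prod: "(\<And>x. x \<in> S \<Longrightarrow> f x \<in> subst_dom g) \<Longrightarrow> prod f S \<in> subst_dom g"
  by (induction S rule: infinite_finite_induct) (auto simp: subst_dom_mult)

text \<open>In \<open>bell_ring\<close> only \<open>LVar 1\<close> may carry a negative
  exponent.\<close>

lemma bell_ring_subset_subst_dom:
  assumes "g 1 dvd 1"
  shows "bell_ring \<subseteq> subst_dom g"
proof -
  have "g i dvd 1 \<or> 0 \<le> Poly_Mapping.lookup m i"
    if "Poly_Mapping.lookup m 0 = 0" "\<forall>i\<ge>2. 0 \<le> Poly_Mapping.lookup m i" for m :: "nat \<Rightarrow>\<^sub>0 int" and i
    using that assms by (cases "i = 0"; cases "i = 1") auto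
  then show ?thesis by (auto simp: bell_ring_def subst_dom_def monom_ok_def)
qed

lemma poly_mapping_eq_sum_single:
  "P = (\<Sum>m \<in> Poly_Mapping.keys P. Poly_Mapping.single m (Poly_Mapping.lookup P m))"
  by (rule poly_mapping_eqI)
     (auto simp: lookup_sum lookup_single when_def in_keys_iff sum.delta)

text \<open>Serves evaluation (the identity), composition (\<open>LConst\<close>) and the passage to
  constant power series (\<open>fps_const\<close> after \<open>h\<close>).\<close>

locale scalar_hom =
  fixes h :: "'a::comm_ring_1 \<Rightarrow> 'r::comm_ring_1"
  assumes h_add: "h (x + y) = h x + h y"
    and h_mult: "h (x * y) = h x * h y"
    and h_1: "h 1 = 1"
begin

lemma h_0: "h 0 = 0"
  using h_add[of 0 0] by simp

lemma h_sum: "h (sum f S) = (\<Sum>x\<in>S. h (f x))"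
  by (induction S rule: infinite_finite_induct) (auto simp: h_0 h_add)

lemma h_prod: "h (prod f S) = (\<Prod>x\<in>S. h (f x))"
  by (induction S rule: infinite_finite_induct) (auto simp: h_1 h_mult)

lemma h_power: "h (x ^ n) = h x ^ n"
  by (induction n) (auto simp: h_1 h_mult)

lemma lsubst_superset:
  assumes "finite S" "Poly_Mapping.keys P \<subseteq> S"
  shows "lsubst h g P = (\<Sum>m\<in>S. h (Poly_Mapping.lookup P m) * monom_subst g m)"
  unfolding lsubst_def monom_subst_def[symmetric] using assms
  by (intro sum.mono_neutral_left) (auto simp: in_keys_iff h_0)

lemma lsubst_0 [simp]: "lsubst h g 0 = 0"
  by (simp add: lsubst_def)

lemma lsubst_single: "lsubst h g (Poly_Mapping.single m c) = h c * monom_subst g m"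
  by (subst lsubst_superset[of "{m}"]) (auto simp: h_0)

lemma lsubst_LConst [simp]: "lsubst h g (LConst c) = h c"
  by (simp add: LConst_def lsubst_single monom_subst_def)

lemma lsubst_1 [simp]: "lsubst h g 1 = 1"
  using lsubst_LConst[of g 1] by (simp add: LConst_def h_1)

lemma lsubst_LVar [simp]: "lsubst h g (LVar i) = g i"
  by (simp add: h_1 LVar_def lsubst_single monom_subst_def)

lemma lsubst_LVar_inv [simp]: "lsubst h g (LVar_inv i) = unit_inv (g i)"
  by (simp add: h_1 LVar_inv_def lsubst_single monom_subst_def unit_powi_def)

lemma lsubst_add: "lsubst h g (P + Q) = lsubst h g P + lsubst h g Q"
proof -
  let ?S = "Poly_Mapping.keys P \<union> Poly_Mapping.keys Q"
  have "lsubst h g (P + Q) = (\<Sum>m\<in>?S. h (Poly_Mapping.lookup (P + Q) m) * monom_subst g m)"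
    using Poly_Mapping.keys_add[of P Q] by (intro lsubst_superset) auto
  then show ?thesis
    by (simp add: lookup_add h_add distrib_right sum.distrib lsubst_superset[of ?S])
qed

lemma lsubst_sum: "lsubst h g (sum f S) = (\<Sum>x\<in>S. lsubst h g (f x))"
  by (induction S rule: infinite_finite_induct) (auto simp: lsubst_add)

lemma lsubst_mult:
  assumes "P \<in> subst_dom g" "Q \<in> subst_dom g"
  shows "lsubst h g (P * Q) = lsubst h g P * lsubst h g Q"
proof -
  let ?K = Poly_Mapping.keys and ?l = Poly_Mapping.lookup
  \<comment> \<open>Expanding both factors into monomials reduces the claim, by additivity, to
    products of two monomials.\<close>
  have "P * Q = (\<Sum>m\<in>?K P. \<Sum>m'\<in>?K Q. Poly_Mapping.single (m + m') (?l P m * ?l Q m'))"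
    by (subst (1) poly_mapping_eq_sum_single[of P], subst (1) poly_mapping_eq_sum_single[of Q])
       (simp add: sum_product mult_single)
  then have "lsubst h g (P * Q) = (\<Sum>m\<in>?K P. \<Sum>m'\<in>?K Q.
      h (?l P m * ?l Q m') * monom_subst g (m + m'))"
    by (simp add: lsubst_sum lsubst_single)
  also have "\<dots> = (\<Sum>m\<in>?K P. \<Sum>m'\<in>?K Q.
      (h (?l P m) * monom_subst g m) * (h (?l Q m') * monom_subst g m'))"
    using assms by (intro sum.cong refl)
      (simp add: subst_dom_def monom_subst_add h_mult mult_ac)
  also have "\<dots> = lsubst h g P * lsubst h g Q"
    by (simp add: sum_product lsubst_def monom_subst_def)
  finally show ?thesis .
qed

lemma lsubst_power: "P \<in> subst_dom g \<Longrightarrow> lsubst h g (P ^ n) = lsubst h g P ^ n"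
  by (induction n) (auto simp: lsubst_mult subst_dom_power)

lemma lsubst_prod:
  "(\<And>x. x \<in> S \<Longrightarrow> f x \<in> subst_dom g) \<Longrightarrow> lsubst h g (prod f S) = (\<Prod>x\<in>S. lsubst h g (f x))"
  by (induction S rule: infinite_finite_induct) (auto simp: lsubst_mult subst_dom_prod)

lemma scalar_hom_fps_const: "scalar_hom (\<lambda>c. fps_const (h c))"
  by unfold_locales (simp_all add: h_add h_mult h_1)

lemma fps_map_power_nth: "(Abs_fps (\<lambda>i. h (fps_nth f i)) ^ k) $ n = h ((f ^ k) $ n)"
proof (induction k arbitrary: n)
  case (Suc k)
  then show ?case by (simp add: fps_mult_nth h_sum h_mult)
qed (simp add: h_0 h_1)

end

interpretation id_hom: scalar_hom "\<lambda>c::'a::comm_ring_1. c"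
  by unfold_locales (rule refl)+

interpretation LConst_hom: scalar_hom "LConst :: 'a::comm_ring_1 \<Rightarrow> 'a lpoly"
proof
  show "LConst (x + y) = LConst x + LConst y" for x y :: 'a
    by (simp only: LConst_def single_add)
  show "LConst (x * y) = LConst x * LConst y" for x y :: 'a
    by (simp only: LConst_def mult_single add_0_left)
  show "LConst (1 :: 'a) = 1"
    by (simp only: LConst_def single_one)
qed

declare LConst_hom.h_0 [simp] LConst_hom.h_1 [simp]


section \<open>Bell polynomials and powers of exponential generating functions\<close>

definition exponents :: "nat set \<Rightarrow> nat \<Rightarrow> (nat \<Rightarrow> nat) set" where
  "exponents S k = {r. (\<forall>i. i \<notin> S \<longrightarrow> r i = 0) \<and> sum r S = k}"

lemma finite_exponents:
  assumes "finite S"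
  shows "finite (exponents S k)"
proof (rule finite_subset)
  show "exponents S k \<subseteq> {r. \<forall>i. (i \<in> S \<longrightarrow> r i \<in> {..k}) \<and> (i \<notin> S \<longrightarrow> r i = 0)}"
    using member_le_sum[of _ S] assms by (fastforce simp: exponents_def)
  show "finite {r. \<forall>i. (i \<in> S \<longrightarrow> r i \<in> {..k}) \<and> (i \<notin> S \<longrightarrow> r i = (0::nat))}"
    by (rule finite_set_of_finite_funs) (use assms in auto)
qed

text \<open>Divided powers absorb the binomial coefficients. The target ring need not allow
  division, so reciprocals of factorials are taken in the field and transported by
  \<open>h\<close>.\<close>

lemma divided_binomial:
  fixes x y :: "'r::comm_ring_1" and h :: "'a::field_char_0 \<Rightarrow> 'r"
  assumes "scalar_hom h"
  shows "h (1 / fact k) * (x + y) ^ k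
    = (\<Sum>j\<le>k. (h (1 / fact j) * x ^ j) * (h (1 / fact (k - j)) * y ^ (k - j)))"
proof -
  interpret scalar_hom h by fact
  have h_of_nat: "h (of_nat m) = of_nat m" for m
    by (induction m) (auto simp: h_add h_0 h_1)
  have coeff: "h (1 / fact k) * of_nat (k choose j) = h (1 / fact j) * h (1 / fact (k - j))"
    if "j \<le> k" for j
  proof -
    have "1 / fact k * of_nat (k choose j) = 1 / fact j * (1 / fact (k - j) :: 'a)"
      using that by (simp add: binomial_fact)
    then show ?thesis by (metis h_mult h_of_nat)
  qed
  have "h (1 / fact k) * (x + y) ^ k
      = (\<Sum>j\<le>k. (h (1 / fact k) * of_nat (k choose j)) * (x ^ j * y ^ (k - j)))"
    by (simp add: binomial_ring sum_distrib_left mult_ac)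
  also have "\<dots> = (\<Sum>j\<le>k. (h (1 / fact j) * h (1 / fact (k - j))) * (x ^ j * y ^ (k - j)))"
    by (intro sum.cong refl) (simp add: coeff)
  finally show ?thesis by (simp add: mult_ac)
qed

text \<open>By induction on \<open>S\<close>, splitting off the exponent of one variable with the
  binomial case; in divided form no multinomial coefficient has to be carried along.\<close>

lemma divided_multinomial:
  fixes y :: "nat \<Rightarrow> 'r::comm_ring_1" and h :: "'a::field_char_0 \<Rightarrow> 'r"
  assumes "scalar_hom h" and fin: "finite S"
  shows "h (1 / fact k) * (\<Sum>i\<in>S. y i) ^ k
    = (\<Sum>r\<in>exponents S k. \<Prod>i\<in>S. h (1 / fact (r i)) * y i ^ r i)"
  using fin
proof (induction S arbitrary: k rule: finite_induct)
  case empty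
  interpret scalar_hom h by fact
  show ?case
  proof (cases "k = 0")
    case True
    then have "exponents {} k = {\<lambda>_. 0}" by (auto simp: exponents_def)
    with True show ?thesis by (simp add: h_1)
  next
    case False
    then have "exponents {} k = {}" by (auto simp: exponents_def)
    with False show ?thesis by (simp add: power_0_left)
  qed
next
  case (insert a S)
  interpret scalar_hom h by fact
  let ?t = "\<lambda>i j. h (1 / fact j) * y i ^ j"
  have upd: "(\<Sum>i\<in>S. if i = a then j else r i) = sum r S" for r :: "nat \<Rightarrow> nat" and j
    using insert.hyps by (intro sum.cong) auto
  have "h (1 / fact k) * (\<Sum>i\<in>insert a S. y i) ^ k
      = (\<Sum>j\<le>k. ?t a j * (h (1 / fact (k - j)) * (\<Sum>i\<in>S. y i) ^ (k - j)))"
    using insert.hyps by (simp add: divided_binomial[OF assms(1)])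
  also have "\<dots> = (\<Sum>j\<le>k. \<Sum>r\<in>exponents S (k - j). ?t a j * (\<Prod>i\<in>S. ?t i (r i)))"
    by (simp add: insert.IH sum_distrib_left)
  also have "\<dots> = (\<Sum>(j, r)\<in>Sigma {..k} (\<lambda>j. exponents S (k - j)).
      ?t a j * (\<Prod>i\<in>S. ?t i (r i)))"
    using finite_exponents[OF insert.hyps(1)] by (subst sum.Sigma) auto
  \<comment> \<open>A vector on \<open>insert a S\<close> corresponds to its value \<open>j\<close>
    at \<open>a\<close> and the vector reset to 0 at \<open>a\<close>, of total
    \<open>k - j\<close>.\<close>
  also have "\<dots> = (\<Sum>r\<in>exponents (insert a S) k. \<Prod>i\<in>insert a S. ?t i (r i))"
  proof (rule sum.reindex_bij_witness[where j = "\<lambda>(j, r). r(a := j)"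
        and i = "\<lambda>r. (r a, r(a := 0))"])
    fix r assume "r \<in> exponents (insert a S) k"
    then show "(r a, r(a := 0)) \<in> Sigma {..k} (\<lambda>j. exponents S (k - j))"
      using insert.hyps by (auto simp: exponents_def upd)
  next
    fix p assume p: "p \<in> Sigma {..k} (\<lambda>j. exponents S (k - j))"
    then show "(case p of (j, r) \<Rightarrow> r(a := j)) \<in> exponents (insert a S) k"
      using insert.hyps by (auto simp: exponents_def upd)
    show "((case p of (j, r) \<Rightarrow> r(a := j)) a, (case p of (j, r) \<Rightarrow> r(a := j))(a := 0)) = p"
      using p insert.hyps by (auto simp: exponents_def fun_upd_idem_iff)
    have "(\<Prod>i\<in>S. ?t i ((r(a := j)) i)) = (\<Prod>i\<in>S. ?t i (r i))" for r j
      using insert.hyps by (intro prod.cong) auto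
    then show "(\<Prod>i\<in>insert a S. ?t i ((case p of (j, r) \<Rightarrow> r(a := j)) i))
        = (case p of (j, r) \<Rightarrow> ?t a j * (\<Prod>i\<in>S. ?t i (r i)))"
      using insert.hyps by (cases p) simp
  qed auto
  finally show ?case .
qed

section \<open>Bell polynomials as coefficients of powers\<close>

lemma bell_types_eq_exponents:
  "bell_types n k = {r \<in> exponents {1..n} k. (\<Sum>i=1..n. i * r i) = n}"
  by (auto simp: bell_types_def exponents_def)

text \<open>For \<open>n < k\<close> no type exists, as all indices are at least 1, and for
  \<open>k = 0\<close> only the zero vector at \<open>n = 0\<close>; so one formula covers every
  case.\<close>

lemma bellB_eq_sum:
  "bellB n k = (\<Sum>r \<in> bell_types n k.
     LConst (fact n / (\<Prod>i=1..n. fact (r i) * fact i ^ r i)) * (\<Prod>i=1..n. LVar i ^ r i))"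
proof -
  have "bell_types n k = {}" if "n < k"
  proof (rule equals0I)
    fix r assume "r \<in> bell_types n k"
    then have "(\<Sum>i=1..n. r i) = k" "(\<Sum>i=1..n. i * r i) = n"
      by (simp_all add: bell_types_def)
    moreover have "(\<Sum>i=1..n. r i) \<le> (\<Sum>i=1..n. i * r i)"
      by (intro sum_mono) auto
    ultimately show False using that by linarith
  qed
  moreover have "bell_types n 0 = (if n = 0 then {\<lambda>_. 0} else {})"
    by (auto simp: bell_types_def)
  ultimately show ?thesis
    by (auto simp: bellB_def)
qed

lemma bellB_in_subst_dom: "bellB n k \<in> subst_dom g"
  unfolding bellB_eq_sum
  by (intro subst_dom_sum subst_dom_mult subst_dom_prod subst_dom_power
      subst_dom_LConst subst_dom_LVar)

text \<open>The constant term is zero because Bell polynomials do not involve \<open>LVar 0\<close>;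
  this also makes such a series admissible as the inner one of a composition.\<close>

definition egf :: "('a::field_char_0 \<Rightarrow> 'r::comm_ring_1) \<Rightarrow> (nat \<Rightarrow> 'r) \<Rightarrow> 'r fps" where
  "egf h g = Abs_fps (\<lambda>i. if i = 0 then 0 else h (1 / fact i) * g i)"

lemma fps_power_nth_cong:
  fixes f g :: "'a::comm_ring_1 fps"
  assumes "\<And>i. i \<le> n \<Longrightarrow> f $ i = g $ i"
  shows "(f ^ k) $ n = (g ^ k) $ n"
proof -
  have "(f ^ k) $ m = (g ^ k) $ m" if "m \<le> n" for m
    using that
  proof (induction k arbitrary: m)
    case (Suc k)
    then show ?case using assms by (auto simp: fps_mult_nth intro!: sum.cong)
  qed simp
  then show ?thesis by simp
qed

text \<open>Truncated at \<open>n\<close>, the series is a finite sum of monomials. The multinomial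
  theorem expands its power, and coefficient \<open>n\<close> selects the exponent vectors of weight
  \<open>n\<close>, which are the Bell types.\<close>

lemma egf_power_nth:
  fixes h :: "'a::field_char_0 \<Rightarrow> 'r::comm_ring_1"
  assumes "scalar_hom h"
  shows "h (1 / fact k) * (egf h g ^ k) $ n = h (1 / fact n) * lsubst h g (bellB n k)"
proof -
  interpret scalar_hom h by fact
  define c where "c i = h (1 / fact i) * g i" for i
  define y where "y i = fps_const (c i) * fps_X ^ i" for i
  define C where "C r = (\<Prod>i=1..n. h (1 / fact (r i)) * c i ^ r i)" for r
  have y_nth: "y i $ m = (if i = m then c i else 0)" for i m
    by (simp add: y_def)
  have "(egf h g ^ k) $ n = ((\<Sum>i=1..n. y i) ^ k) $ n"
  proof (rule fps_power_nth_cong)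
    fix m assume "m \<le> n"
    then show "egf h g $ m = (\<Sum>i=1..n. y i) $ m"
      by (auto simp: egf_def fps_sum_nth y_nth c_def)
  qed
  then have "h (1 / fact k) * (egf h g ^ k) $ n
      = (fps_const (h (1 / fact k)) * (\<Sum>i=1..n. y i) ^ k) $ n"
    by simp
  \<comment> \<open>The multinomial theorem is applied in the power series ring.\<close>
  also have "\<dots> = (\<Sum>r\<in>exponents {1..n} k.
      (\<Prod>i=1..n. fps_const (h (1 / fact (r i))) * y i ^ r i) $ n)"
    by (subst divided_multinomial[OF scalar_hom_fps_const]) (simp_all add: fps_sum_nth)
  also have "\<dots> = (\<Sum>r\<in>exponents {1..n} k. if (\<Sum>i=1..n. i * r i) = n then C r else 0)"
  proof (rule sum.cong[OF refl])
    fix r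
    have const_prod: "(\<Prod>i\<in>I. fps_const (f i)) = fps_const (\<Prod>i\<in>I. f i)"
      for f :: "nat \<Rightarrow> 'r" and I
      by (induction I rule: infinite_finite_induct) auto
    have "(\<Prod>i=1..n. fps_const (h (1 / fact (r i))) * y i ^ r i)
        = (\<Prod>i=1..n. fps_const (h (1 / fact (r i)) * c i ^ r i) * fps_X ^ (i * r i))"
      by (intro prod.cong refl)
         (simp add: y_def power_mult_distrib power_mult fps_const_power mult.assoc[symmetric])
    also have "\<dots> = fps_const (C r) * fps_X ^ (\<Sum>i=1..n. i * r i)"
      by (simp only: prod.distrib power_sum const_prod C_def)
    finally show "(\<Prod>i=1..n. fps_const (h (1 / fact (r i))) * y i ^ r i) $ n
        = (if (\<Sum>i=1..n. i * r i) = n then C r else 0)"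
      by auto
  qed
  also have "\<dots> = (\<Sum>r\<in>bell_types n k. C r)"
    unfolding bell_types_eq_exponents using finite_exponents[of "{1..n}" k]
    by (simp only: sum.inter_filter finite_atLeastAtMost)
  also have "\<dots> = (\<Sum>r\<in>bell_types n k. h (1 / fact n) *
      (h (fact n / (\<Prod>i=1..n. fact (r i) * fact i ^ r i)) * (\<Prod>i=1..n. g i ^ r i)))"
  proof (rule sum.cong[OF refl])
    fix r
    have "C r = h (\<Prod>i=1..n. 1 / (fact (r i) * fact i ^ r i)) * (\<Prod>i=1..n. g i ^ r i)"
      unfolding C_def h_prod prod.distrib[symmetric]
    proof (intro prod.cong refl)
      fix i
      have "(1 :: 'a) / (fact (r i) * fact i ^ r i) = 1 / fact (r i) * (1 / fact i) ^ r i"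
        by (simp add: power_divide)
      then show "h (1 / fact (r i)) * c i ^ r i
          = h (1 / (fact (r i) * fact i ^ r i)) * g i ^ r i"
        by (simp only: h_mult h_power c_def power_mult_distrib mult_ac)
    qed
    also have "(\<Prod>i=1..n. 1 / (fact (r i) * fact i ^ r i))
        = 1 / fact n * (fact n / (\<Prod>i=1..n. fact (r i) * fact i ^ r i) :: 'a)"
      by (simp add: prod_dividef)
    finally show "C r = h (1 / fact n) *
      (h (fact n / (\<Prod>i=1..n. fact (r i) * fact i ^ r i)) * (\<Prod>i=1..n. g i ^ r i))"
      by (simp only: h_mult mult.assoc)
  qed
  also have "\<dots> = h (1 / fact n) * lsubst h g (bellB n k)"
    unfolding bellB_eq_sum
    by (simp add: lsubst_sum lsubst_mult lsubst_prod lsubst_power subst_dom_prod subst_dom_power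
        sum_distrib_left)
  finally show ?thesis .
qed

lemma lsubst_bellB:
  fixes h :: "'a::field_char_0 \<Rightarrow> 'r::comm_ring_1"
  assumes "scalar_hom h"
  shows "lsubst h g (bellB n k) = h (fact n / fact k) * (egf h g ^ k) $ n"
proof -
  interpret scalar_hom h by fact
  have "lsubst h g (bellB n k) = h (fact n) * (h (1 / fact n) * lsubst h g (bellB n k))"
    by (simp add: mult.assoc[symmetric] h_mult[symmetric] h_1)
  also have "\<dots> = (h (fact n) * h (1 / fact k)) * (egf h g ^ k) $ n"
    by (simp add: egf_power_nth[OF assms, symmetric] mult.assoc)
  finally show ?thesis by (simp add: h_mult[symmetric])
qed

lemma bellB_less: "n < k \<Longrightarrow> bellB n k = 0"
  by (simp add: bellB_def)

text \<open>Exhibits \<open>bellB\<close> itself, up to factorials, as a coefficient of a power of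
  the generic series \<open>egf LConst LVar\<close>.\<close>

lemma lsubst_LConst_LVar_bellB: "lsubst LConst LVar (bellB n k) = bellB n k"
  unfolding bellB_eq_sum
  by (simp add: LConst_hom.lsubst_sum LConst_hom.lsubst_mult LConst_hom.lsubst_prod
      LConst_hom.lsubst_power subst_dom_prod subst_dom_power)

text \<open>Faa di Bruno's formula in matrix form.\<close>

lemma bellB_linear_subst:
  fixes t :: "nat \<Rightarrow> 'a::field_char_0" and G :: "nat \<Rightarrow> 'a lpoly"
  assumes G: "\<And>n. 1 \<le> n \<Longrightarrow> G n = (\<Sum>k=1..n. LConst (leval t (bellB n k)) * LVar k)"
  shows "lcompose (bellB n k) G = (\<Sum>i\<le>n. LConst (leval t (bellB n i)) * bellB i k)"
proof -
  let ?T = "egf (\<lambda>c. c) t"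
  \<comment> \<open>The numerical series with its coefficients regarded as constant Laurent
    polynomials, so that the generic series can be composed with it.\<close>
  define T where "T = Abs_fps (\<lambda>i. LConst (?T $ i))"
  have T_pow: "(T ^ i) $ m = LConst ((?T ^ i) $ m)" for i m
    unfolding T_def by (rule LConst_hom.fps_map_power_nth)
  have T0: "T $ 0 = 0" by (simp add: T_def egf_def)
  \<comment> \<open>The weight of \<open>LVar i\<close> in \<open>G m\<close> is, up to factorials,
    coefficient \<open>m\<close> of \<open>T ^ i\<close>; this is what composition produces.\<close>
  have "egf LConst G = egf LConst LVar oo T"
  proof (rule fps_ext)
    fix m
    show "egf LConst G $ m = (egf LConst LVar oo T) $ m"
    proof (cases "m = 0")
      case True
      then show ?thesis by (simp add: egf_def)
    next
      case False
      have "egf LConst G $ m = (\<Sum>i=1..m. LConst (1 / fact m) * (LConst (leval t (bellB m i)) * LVar i))"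
        using False by (simp add: egf_def G sum_distrib_left)
      also have "\<dots> = (\<Sum>i=1..m. egf LConst LVar $ i * (T ^ i) $ m)"
      proof (rule sum.cong[OF refl])
        fix i assume "i \<in> {1..m}"
        have "LConst (1 / fact m) * LConst (leval t (bellB m i)) = LConst (1 / fact i) * (T ^ i) $ m"
          by (simp only: T_pow LConst_hom.h_mult[symmetric] lsubst_bellB[OF id_hom.scalar_hom_axioms])
             simp
        then show "LConst (1 / fact m) * (LConst (leval t (bellB m i)) * LVar i)
            = egf LConst LVar $ i * (T ^ i) $ m"
          using \<open>i \<in> {1..m}\<close> by (simp add: egf_def mult.assoc[symmetric])
      qed
      also have "\<dots> = (\<Sum>i=0..m. egf LConst LVar $ i * (T ^ i) $ m)"
        by (intro sum.mono_neutral_left) (auto simp: egf_def not_less_eq_eq)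
      finally show ?thesis by (simp add: fps_compose_nth)
    qed
  qed
  \<comment> \<open>Composition commutes with powers, since \<open>T\<close> has zero constant
    term.\<close>
  then have "(egf LConst G ^ k) $ n = (\<Sum>i=0..n. (egf LConst LVar ^ k) $ i * (T ^ i) $ n)"
    by (simp add: fps_compose_power[OF T0] fps_compose_nth)
  then have "lcompose (bellB n k) G
      = (\<Sum>i=0..n. LConst (fact n / fact k) * ((egf LConst LVar ^ k) $ i * (T ^ i) $ n))"
    by (simp add: lsubst_bellB[OF LConst_hom.scalar_hom_axioms] sum_distrib_left)
  also have "\<dots> = (\<Sum>i=0..n. LConst (leval t (bellB n i)) * bellB i k)"
  proof (rule sum.cong[OF refl])
    fix i
    have B: "bellB i k = LConst (fact i / fact k) * (egf LConst LVar ^ k) $ i"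
      using lsubst_bellB[OF LConst_hom.scalar_hom_axioms, of LVar i k]
      by (simp only: lsubst_LConst_LVar_bellB)
    \<comment> \<open>The factor \<open>fact n / fact k\<close> splits through
      \<open>fact i\<close>, one part for each matrix.\<close>
    have "LConst (leval t (bellB n i)) * bellB i k
        = LConst (fact n / fact i) * (T ^ i) $ n * (LConst (fact i / fact k) * (egf LConst LVar ^ k) $ i)"
      by (simp only: B T_pow LConst_hom.h_mult lsubst_bellB[OF id_hom.scalar_hom_axioms])
    also have "\<dots> = LConst (fact n / fact i) * LConst (fact i / fact k)
        * ((egf LConst LVar ^ k) $ i * (T ^ i) $ n)"
      by (simp only: mult_ac)
    finally show "LConst (fact n / fact k) * ((egf LConst LVar ^ k) $ i * (T ^ i) $ n)
        = LConst (leval t (bellB n i)) * bellB i k"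
      by (simp add: LConst_hom.h_mult[symmetric])
  qed
  finally show ?thesis by (simp add: atLeast0AtMost)
qed


section \<open>Triangular inverses\<close>

text \<open>Row \<open>n\<close> is compared column by column from right to left. The diagonal entry
  \<open>B k k\<close> is a unit because \<open>P k k\<close> inverts it, so it can be
  cancelled.\<close>

lemma triangular_left_inverse_unique:
  fixes P Q B :: "nat \<Rightarrow> nat \<Rightarrow> 'r::comm_ring_1"
  assumes P: "\<And>n k. n < k \<Longrightarrow> P n k = 0" and Q: "\<And>n k. n < k \<Longrightarrow> Q n k = 0"
    and B: "\<And>n k. n < k \<Longrightarrow> B n k = 0"
    and PB: "\<And>n k. (\<Sum>j\<le>n. P n j * B j k) = (if n = k then 1 else 0)"
    and QB: "\<And>n k. (\<Sum>j\<le>n. Q n j * B j k) = (if n = k then 1 else 0)"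
  shows "P n k = Q n k"
proof (induction "n - k" arbitrary: k rule: less_induct)
  case less
  show ?case
  proof (cases "n < k")
    case True
    then show ?thesis by (simp add: P Q)
  next
    case False
    have unit: "P k k * B k k = 1"
    proof -
      have "(\<Sum>j\<le>k. P k j * B j k) = P k k * B k k"
        by (subst sum.remove[of _ k]) (auto intro!: sum.neutral simp: B)
      then show ?thesis using PB[of k k] by simp
    qed
    have "0 = (\<Sum>j\<le>n. (P n j - Q n j) * B j k)"
      by (simp add: left_diff_distrib sum_subtractf PB QB)
    also have "\<dots> = (P n k - Q n k) * B k k"
    proof (subst sum.remove[of _ k])
      \<comment> \<open>Terms with \<open>j < k\<close> vanish by triangularity of \<open>B\<close>,
        those with \<open>j > k\<close> by induction.\<close>
      have "(P n j - Q n j) * B j k = 0" if "j \<le> n" "j \<noteq> k" for j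
      proof (cases "j < k")
        case False
        then have "P n j = Q n j" using that less by simp
        then show ?thesis by simp
      qed (simp add: B)
      then show "(P n k - Q n k) * B k k + (\<Sum>j\<in>{..n} - {k}. (P n j - Q n j) * B j k)
          = (P n k - Q n k) * B k k"
        by (auto intro!: sum.neutral)
    qed (use False in auto)
    finally have "(P n k - Q n k) * B k k * P k k = 0"
      by simp
    then have "(P n k - Q n k) * (P k k * B k k) = 0"
      by (simp only: mult_ac)
    then show ?thesis by (simp add: unit)
  qed
qed

section \<open>The family \<open>bellA\<close> as an inverse matrix\<close>

lemma bellA_less: "n < k \<Longrightarrow> bellA n k = 0"
  using is_bellA_bellA unfolding is_bellA_def by blast

lemma bellA_in_bell_ring: "bellA n k \<in> bell_ring"
  using is_bellA_bellA unfolding is_bellA_def by blast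

text \<open>A range independent of \<open>k\<close> turns the defining relation into a full matrix
  identity, valid also for \<open>k > n\<close>.\<close>

lemma bellA_bellB_sum: "(\<Sum>j\<le>n. bellA n j * bellB j k) = (if n = k then 1 else 0)"
proof (cases "k \<le> n")
  case True
  then have "(\<Sum>j\<le>n. bellA n j * bellB j k) = (\<Sum>j=k..n. bellA n j * bellB j k)"
    by (intro sum.mono_neutral_right) (auto simp: bellB_less)
  also have "\<dots> = (if n = k then 1 else 0)"
    using is_bellA_bellA True unfolding is_bellA_def by blast
  finally show ?thesis .
qed (auto simp: bellB_less intro!: sum.neutral)

lemma lsubst_bellA_bellB_sum:
  fixes h :: "'a::field_char_0 \<Rightarrow> 'r::comm_ring_1"
  assumes "scalar_hom h" and g: "g 1 dvd 1"
  shows "(\<Sum>j\<le>n. lsubst h g (bellA n j) * lsubst h g (bellB j k)) = (if n = k then 1 else 0)"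
proof -
  interpret scalar_hom h by fact
  have "(bellA n j :: 'a lpoly) \<in> subst_dom g" for n j
    using bell_ring_subset_subst_dom[of g, OF g] bellA_in_bell_ring by blast
  then have "(\<Sum>j\<le>n. lsubst h g (bellA n j) * lsubst h g (bellB j k))
      = lsubst h g (\<Sum>j\<le>n. bellA n j * bellB j k)"
    by (simp add: lsubst_sum lsubst_mult bellB_in_subst_dom)
  then show ?thesis by (simp add: bellA_bellB_sum h_0)
qed

text \<open>Both sides are lower triangular left inverses of \<open>lcompose (bellB n k) G\<close>.
  Faa di Bruno factors that matrix as \<open>B(t) B\<close>, so the inverses multiply in reverse
  order.\<close>

lemma bellA_linear_subst:
  fixes t :: "nat \<Rightarrow> 'a::field_char_0" and G :: "nat \<Rightarrow> 'a lpoly"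
  assumes G: "\<And>n. 1 \<le> n \<Longrightarrow> G n = (\<Sum>k=1..n. LConst (leval t (bellB n k)) * LVar k)"
    and t: "t 1 \<noteq> 0"
  shows "lcompose (bellA n k) G = (\<Sum>j\<le>n. bellA n j * LConst (leval t (bellA j k)))"
proof (rule triangular_left_inverse_unique[where B = "\<lambda>n k. lcompose (bellB n k) G"
      and P = "\<lambda>n k. lcompose (bellA n k) G"
      and Q = "\<lambda>n k. \<Sum>j\<le>n. bellA n j * LConst (leval t (bellA j k))"])
  have "leval t (bellB 1 1) = t 1"
    using bellB_diag[of 1, where 'a = 'a] by simp
  \<comment> \<open>The value substituted for \<open>LVar 1\<close> is a nonzero multiple of
    \<open>LVar 1\<close>, hence a unit of the Laurent ring; this makes composition with
    \<open>bellA\<close> multiplicative.\<close>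
  then have G1: "G 1 = LConst (t 1) * LVar 1"
    using G[of 1] by simp
  have "LConst (t 1) * LConst (1 / t 1) = 1"
    using t by (simp add: LConst_hom.h_mult[symmetric])
  then have "(LConst (t 1) * LConst (1 / t 1)) * (LVar 1 * LVar_inv 1) = (1 :: 'a lpoly)"
    by (simp only: LVar_LVar_inv mult_1_left)
  then have "1 = G 1 * (LConst (1 / t 1) * LVar_inv 1)"
    by (simp only: G1 mult_ac)
  then have unit: "G 1 dvd 1" by (rule dvdI)
  show "(\<Sum>j\<le>n. lcompose (bellA n j) G * lcompose (bellB j k) G) = (if n = k then 1 else 0)" for n k
    by (rule lsubst_bellA_bellB_sum[of _ G, OF LConst_hom.scalar_hom_axioms unit])
  let ?a = "\<lambda>n k. LConst (leval t (bellA n k)) :: 'a lpoly"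
  let ?b = "\<lambda>n k. LConst (leval t (bellB n k)) :: 'a lpoly"
  \<comment> \<open>The common bound \<open>n\<close> keeps all ranges independent, so that the sums
    below can be exchanged.\<close>
  have ab: "(\<Sum>j\<le>n. ?a i j * ?b j l) = (if i = l then 1 else 0)" if "i \<le> n" for i l n
  proof -
    have "(\<Sum>j\<le>n. ?a i j * ?b j l) = (\<Sum>j\<le>i. ?a i j * ?b j l)"
      using that by (intro sum.mono_neutral_right) (auto simp: bellA_less)
    also have "\<dots> = LConst (\<Sum>j\<le>i. leval t (bellA i j) * leval t (bellB j l))"
      by (simp add: LConst_hom.h_sum LConst_hom.h_mult)
    also have "\<dots> = LConst (if i = l then 1 else 0)"
      using t by (subst lsubst_bellA_bellB_sum[OF id_hom.scalar_hom_axioms]) (auto simp: dvd_field_iff)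
    finally show ?thesis by simp
  qed
  show "(\<Sum>j\<le>n. (\<Sum>i\<le>n. bellA n i * ?a i j) * lcompose (bellB j k) G) = (if n = k then 1 else 0)" for n k
  proof -
    have B: "lcompose (bellB j k) G = (\<Sum>l\<le>n. ?b j l * bellB l k)" if "j \<le> n" for j
    proof -
      have "lcompose (bellB j k) G = (\<Sum>l\<le>j. ?b j l * bellB l k)"
        by (rule bellB_linear_subst) (rule G)
      also have "\<dots> = (\<Sum>l\<le>n. ?b j l * bellB l k)"
        using that by (intro sum.mono_neutral_left) (auto simp: bellB_less)
      finally show ?thesis .
    qed
    \<comment> \<open>Associativity of \<open>A A(t) B(t) B\<close>: the inner pair collapses first,
      by \<open>ab\<close>, then the outer pair.\<close>
    have "(\<Sum>j\<le>n. (\<Sum>i\<le>n. bellA n i * ?a i j) * lcompose (bellB j k) G)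
        = (\<Sum>j\<le>n. \<Sum>i\<le>n. \<Sum>l\<le>n. bellA n i * (?a i j * ?b j l) * bellB l k)"
    proof (rule sum.cong[OF refl])
      fix j assume "j \<in> {..n}"
      then show "(\<Sum>i\<le>n. bellA n i * ?a i j) * lcompose (bellB j k) G
          = (\<Sum>i\<le>n. \<Sum>l\<le>n. bellA n i * (?a i j * ?b j l) * bellB l k)"
        by (simp only: B atMost_iff sum_product mult.assoc)
    qed
    also have "\<dots> = (\<Sum>i\<le>n. \<Sum>j\<le>n. \<Sum>l\<le>n. bellA n i * (?a i j * ?b j l) * bellB l k)"
      by (rule sum.swap)
    also have "\<dots> = (\<Sum>i\<le>n. \<Sum>l\<le>n. \<Sum>j\<le>n. bellA n i * (?a i j * ?b j l) * bellB l k)"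
      by (rule sum.cong[OF refl], rule sum.swap)
    also have "\<dots> = (\<Sum>i\<le>n. \<Sum>l\<le>n. bellA n i * (\<Sum>j\<le>n. ?a i j * ?b j l) * bellB l k)"
      by (simp only: sum_distrib_left sum_distrib_right)
    also have "\<dots> = (\<Sum>i\<le>n. \<Sum>l\<le>n. if i = l then bellA n i * bellB i k else 0)"
      by (intro sum.cong refl) (auto simp: ab)
    also have "\<dots> = (\<Sum>i\<le>n. bellA n i * bellB i k)"
      by (intro sum.cong refl) simp
    finally show ?thesis by (simp add: bellA_bellB_sum)
  qed
qed (auto simp: bellA_less bellB_less intro!: sum.neutral)


section \<open>The case of the constant function\<close>

lemma taylor_one: "taylor 1 j = (if j = 0 then 1 else 0)"
proof (cases j)
  case (Suc i)
  have "(fps_deriv ^^ i) (0 :: 'a fps) = 0" by (induction i) auto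
  then show ?thesis using Suc by (simp add: taylor_def funpow_Suc_right del: funpow.simps)
qed (simp add: taylor_def)

text \<open>Only the term \<open>j = n\<close> survives. This is the form that
  \<open>bellA_linear_subst\<close> requires.\<close>

lemma Gam_one: "Gam 1 \<phi> n = (\<Sum>k=1..n. LConst (at_zero (bellB n k) \<phi>) * LVar k)"
proof -
  have "(\<Sum>j=k..n. of_nat (n choose j) * taylor 1 (n - j) * at_zero (bellB j k) \<phi>)
      = at_zero (bellB n k) \<phi>" if "k \<le> n" for k
    using that by (subst sum.remove[of _ n]) (auto intro!: sum.neutral simp: taylor_one)
  then show ?thesis by (simp add: Gam_def)
qed

text \<open>\<open>recipR\<close> gives the Taylor coefficients of the reciprocal series, and 1 is
  its own reciprocal.\<close>

lemma leval_taylor_one_recipR: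
  "leval (taylor 1) (recipR m) = (if m = 0 then 1 else (0 :: 'a::field_char_0))"
proof -
  let ?t = "taylor 1 :: nat \<Rightarrow> 'a"
  have inv: "unit_inv (1 :: 'a) = 1"
    using unit_inv_right[of "1 :: 'a"] by simp
  \<comment> \<open>\<open>egf\<close> discards the constant term, so nothing remains of the series
    1.\<close>
  have egf0: "egf (\<lambda>c. c) ?t = 0"
    by (rule fps_ext) (simp add: egf_def taylor_one)
  have B: "leval ?t (bellB m i) = (if m = 0 \<and> i = 0 then 1 else 0)" for i
    by (simp add: lsubst_bellB[OF id_hom.scalar_hom_axioms] egf0 power_0_left)
  have dom: "LVar_inv 0 \<in> subst_dom ?t"
    by (rule subst_dom_LVar_inv) (simp add: taylor_one)
  have "leval ?t (recipR m)
      = (\<Sum>i=0..m. (- 1) ^ i * fact i * unit_inv (?t 0) ^ (i + 1) * leval ?t (bellB m i))"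
    unfolding recipR_def
    by (simp only: id_hom.lsubst_sum id_hom.lsubst_mult id_hom.lsubst_power id_hom.lsubst_LConst
        id_hom.lsubst_LVar_inv subst_dom_mult subst_dom_power dom subst_dom_LConst bellB_in_subst_dom)
  also have "\<dots> = (if m = 0 then 1 else 0)"
    by (auto simp: B taylor_one inv intro!: sum.neutral)
  finally show ?thesis .
qed

text \<open>Only the term \<open>j = k\<close> survives, by the preceding evaluation of
  \<open>recipR\<close>.\<close>

lemma Gam_bar_one: "Gam_bar 1 \<psi> n = (\<Sum>k=0..n. LConst (at_zero (bellA n k) \<psi>) * LVar k)"
proof -
  have "(\<Sum>j=k..n. of_nat (j choose k) * leval (taylor 1) (recipR (j - k)) * at_zero (bellA n j) \<psi>)
      = at_zero (bellA n k) \<psi>" if "k \<le> n" for k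
    using that by (subst sum.remove[of _ k]) (auto intro!: sum.neutral simp: leval_taylor_one_recipR)
  then show ?thesis by (simp add: Gam_bar_def)
qed

theorem theorem7p10:
  fixes \<phi> \<psi> :: "'a::field_char_0 fps" and n :: nat
  assumes "\<phi> \<in> Fstar" and "\<psi> \<in> Fstar" and "n \<ge> 1"
  shows "Lambda_one n \<phi> \<psi> =
    (\<Sum>k=1..n. LConst (at_zero (bellA n k) \<psi>) *
       (\<Sum>j=1..k. LConst (at_zero (bellA j 1) \<phi>) * bellA k j))"
proof -
  have t: "taylor \<phi> 1 \<noteq> 0"
    using assms(1) by (simp add: Fstar_def taylor_def)
  have A: "lcompose (bellA k 1) (Gam 1 \<phi>) = (\<Sum>j=1..k. LConst (at_zero (bellA j 1) \<phi>) * bellA k j)" for k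
  proof -
    have "lcompose (bellA k 1) (Gam 1 \<phi>) = (\<Sum>j\<le>k. bellA k j * LConst (at_zero (bellA j 1) \<phi>))"
      by (rule bellA_linear_subst[OF Gam_one t])
    \<comment> \<open>Index 0 drops out because \<open>bellA 0 1 = 0\<close>.\<close>
    also have "\<dots> = (\<Sum>j=1..k. bellA k j * LConst (at_zero (bellA j 1) \<phi>))"
      by (intro sum.mono_neutral_right) (auto simp: bellA_less not_less_eq_eq)
    finally show ?thesis by (simp add: mult.commute)
  qed
  have "Lambda_one n \<phi> \<psi> = (\<Sum>k=0..n. LConst (at_zero (bellA n k) \<psi>) *
       (\<Sum>j=1..k. LConst (at_zero (bellA j 1) \<phi>) * bellA k j))"
    unfolding Lambda_one_def Gam_bar_one
    by (simp add: LConst_hom.lsubst_sum LConst_hom.lsubst_mult A[simplified])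
  \<comment> \<open>At \<open>k = 0\<close> the inner sum is empty.\<close>
  also have "\<dots> = (\<Sum>k=1..n. LConst (at_zero (bellA n k) \<psi>) *
       (\<Sum>j=1..k. LConst (at_zero (bellA j 1) \<phi>) * bellA k j))"
    by (intro sum.mono_neutral_right) (auto simp: not_less_eq_eq)
  finally show ?thesis .
qed

end
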